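(* Let $a,b>0$ and $v\in(0,1)$. Put $h=\frac{b}{a}$, $r=\min\{v,1-v\}$, $r_1=\min\{2r,1-2r\}$ and $\hat r_1=\min\{2r_1,1-2r_1\}$. (I) If $0<v\le\frac12$, then $$(1-v)a+vb\ \le\ (1-v)(\sqrt a-\sqrt b)^2-r_1(\sqrt[4]{ab}-\sqrt b)^2+\mathrm{K}(\sqrt[4]{h},2)^{-\hat r_1}\,a^{1-v}b^v.$$ (II) If $\frac12<v<1$, then $$(1-v)a+vb\ \le\ v(\sqrt a-\sqrt b)^2-r_1(\sqrt[4]{ab}-\sqrt a)^2+\mathrm{K}(\sqrt[4]{h},2)^{-\hat r_1}\,a^{1-v}b^v.$$
   Context: For $t>0$, $\mathrm{K}(t,2)=\frac{(t+1)^2}{4t}$ denotes the Kantorovich constant. *)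

theory Defs
  imports Complex_Main
begin

(* K(t,2) for t > 0; only the second argument 2 is needed, so it is part of the name. *)
definition kantorovich2 :: "real \<Rightarrow> real" where
  "kantorovich2 t = (t + 1)\<^sup>2 / (4 * t)"

end

theory Submission
  imports Defs "HOL-Analysis.Convex"
begin

text \<open>
  For \<open>v \<le> 1 / 2\<close>, with \<open>G = a powr v * b powr (1 - v)\<close> and \<open>t = root 4 h\<close>, the refined Young inequality
  bounds \<open>kantorovich2 t powr r1' * G\<close> above by \<open>(1 - v) * b + v * a\<close> minus two squares.
  By the arithmetic-geometric mean inequality, its sum with
  \<open>kantorovich2 t powr (- r1') * (a powr (1 - v) * b powr v)\<close> is at least \<open>2 * sqrt (a * b)\<close>,
  which gives (I). Exchanging \<open>a\<close> with \<open>b\<close> and \<open>v\<close> with \<open>1 - v\<close> gives (II).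
  Taking fourth roots \<open>p\<close>, \<open>q\<close> of \<open>a\<close>, \<open>b\<close>, the refined Young inequality reduces to
  Young's inequality with a Kantorovich factor for \<open>p\<close> and \<open>q\<close>.
\<close>

lemma kantorovich2_pos: "t > 0 \<Longrightarrow> kantorovich2 t > 0"
  by (simp add: kantorovich2_def)

lemma kantorovich2_inverse: "t > 0 \<Longrightarrow> kantorovich2 (1 / t) = kantorovich2 t"
  by (simp add: kantorovich2_def field_simps power2_eq_square)

text \<open>\<open>kantorovich2 (p / q)\<close> is the squared ratio of the arithmetic to the
  geometric mean of \<open>p\<close> and \<open>q\<close>. Its power trades
  \<open>(p * q) powr \<mu>\<close> for a power of \<open>(p + q) / 2\<close>, leaving Young's
  inequality for \<open>(p + q) / 2\<close> and \<open>q\<close> with weights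
  \<open>2 * \<mu>\<close> and \<open>1 - 2 * \<mu>\<close>.\<close>

lemma young_kantorovich_half:
  fixes p q \<mu> :: real
  assumes "p > 0" "q > 0" "0 \<le> \<mu>" "\<mu> \<le> 1 / 2"
  shows "kantorovich2 (p / q) powr \<mu> * (p powr \<mu> * q powr (1 - \<mu>)) \<le> \<mu> * p + (1 - \<mu>) * q"
proof -
  have "kantorovich2 (p / q) * (p * q) = ((p + q) / 2)\<^sup>2"
    using assms by (simp add: kantorovich2_def field_simps power2_eq_square)
  then have "kantorovich2 (p / q) powr \<mu> * (p * q) powr \<mu> = ((p + q) / 2) powr (2 * \<mu>)"
    using assms kantorovich2_pos[of "p / q"]
    by (simp flip: powr_mult powr_powr add: powr_numeral)
  moreover have "q powr (1 - \<mu>) = q powr \<mu> * q powr (1 - 2 * \<mu>)"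
    by (simp flip: powr_add)
  ultimately have "kantorovich2 (p / q) powr \<mu> * (p powr \<mu> * q powr (1 - \<mu>))
      = ((p + q) / 2) powr (2 * \<mu>) * q powr (1 - 2 * \<mu>)"
    using assms by (simp add: powr_mult mult_ac)
  also have "\<dots> \<le> (2 * \<mu>) * ((p + q) / 2) + (1 - 2 * \<mu>) * q"
    using assms by (intro Youngs_inequality_0) auto
  also have "\<dots> = \<mu> * p + (1 - \<mu>) * q"
    by (simp add: field_simps)
  finally show ?thesis .
qed

lemma young_kantorovich:
  fixes p q \<mu> :: real
  assumes "p > 0" "q > 0" "0 \<le> \<mu>" "\<mu> \<le> 1"
  shows "kantorovich2 (p / q) powr min \<mu> (1 - \<mu>) * (p powr \<mu> * q powr (1 - \<mu>))
    \<le> \<mu> * p + (1 - \<mu>) * q"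
proof (cases "\<mu> \<le> 1 / 2")
  case True
  then show ?thesis
    using young_kantorovich_half[of p q \<mu>] assms by (simp add: min_def)
next
  case False
  then show ?thesis
    using young_kantorovich_half[of q p "1 - \<mu>"] kantorovich2_inverse[of "p / q"] assms
    by (simp add: min_def mult_ac)
qed

text \<open>Subtracting the square cancels one term of the right side, which becomes a monomial
  times a weighted mean of \<open>p\<close> and \<open>q\<close>: the monomial is
  \<open>q ^ 3\<close> and \<open>p\<close> has weight \<open>4 * v\<close> if
  \<open>v \<le> 1 / 4\<close>, otherwise they are \<open>p * q\<^sup>2\<close> and
  \<open>4 * v - 1\<close>.\<close>

lemma refined_young_kantorovich:
  fixes p q v r1 :: real
  assumes "p > 0" "q > 0" "0 \<le> v" "v \<le> 1 / 2" and r1: "r1 = min (2 * v) (1 - 2 * v)"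
  shows "kantorovich2 (p / q) powr min (2 * r1) (1 - 2 * r1) * (p powr (4 * v) * q powr (4 - 4 * v))
    \<le> (1 - 2 * v) * q ^ 4 + 2 * v * (p * q)\<^sup>2 - r1 * (p * q - q\<^sup>2)\<^sup>2"
proof (cases "v \<le> 1 / 4")
  case True
  have "q powr (4 - 4 * v) = q powr (3 + (1 - 4 * v))" by simp
  also have "\<dots> = q ^ 3 * q powr (1 - 4 * v)"
    using assms by (simp only: powr_add powr_numeral)
  finally have q: "q powr (4 - 4 * v) = q ^ 3 * q powr (1 - 4 * v)" .
  have "q ^ 3 * (kantorovich2 (p / q) powr min (4 * v) (1 - 4 * v)
        * (p powr (4 * v) * q powr (1 - 4 * v)))
      \<le> q ^ 3 * (4 * v * p + (1 - 4 * v) * q)"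
    using assms True by (intro mult_left_mono young_kantorovich) auto
  moreover have "r1 = 2 * v"
    using True r1 by simp
  ultimately show ?thesis
    unfolding q by (simp add: power2_eq_square power3_eq_cube power4_eq_xxxx algebra_simps)
next
  case False
  have p: "p powr (4 * v) = p * p powr (4 * v - 1)"
    using assms by (simp add: powr_diff)
  have "q powr (4 - 4 * v) = q powr (2 + (1 - (4 * v - 1)))" by simp
  also have "\<dots> = q ^ 2 * q powr (1 - (4 * v - 1))"
    using assms by (simp only: powr_add powr_numeral)
  finally have q: "q powr (4 - 4 * v) = q\<^sup>2 * q powr (1 - (4 * v - 1))" .
  have "p * q\<^sup>2 * (kantorovich2 (p / q) powr min (4 * v - 1) (1 - (4 * v - 1))
        * (p powr (4 * v - 1) * q powr (1 - (4 * v - 1))))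
      \<le> p * q\<^sup>2 * ((4 * v - 1) * p + (1 - (4 * v - 1)) * q)"
    using assms False by (intro mult_left_mono young_kantorovich) auto
  moreover have r: "r1 = 1 - 2 * v"
    using False r1 by simp
  moreover have m: "min (2 * (1 - 2 * v)) (1 - 2 * (1 - 2 * v)) = min (4 * v - 1) (1 - (4 * v - 1))"
    by (simp add: min.commute)
  ultimately show ?thesis
    unfolding p q r m by (simp add: power2_eq_square power4_eq_xxxx algebra_simps)
qed

lemma reverse_young_kantorovich:
  fixes a b v r1 r1' :: real
  assumes "a > 0" "b > 0" "0 \<le> v" "v \<le> 1 / 2"
    and r1: "r1 = min (2 * v) (1 - 2 * v)" and r1': "r1' = min (2 * r1) (1 - 2 * r1)"
  shows "(1 - v) * a + v * b
    \<le> (1 - v) * (sqrt a - sqrt b)\<^sup>2 - r1 * (root 4 (a * b) - sqrt b)\<^sup>2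
      + kantorovich2 (root 4 (a / b)) powr (- r1') * (a powr (1 - v) * b powr v)"
proof -
  define p where "p = root 4 a"
  define q where "q = root 4 b"
  have pos: "p > 0" "q > 0" and a: "a = p ^ 4" and b: "b = q ^ 4"
    using assms by (simp_all add: p_def q_def)
  have sqrt: "sqrt a = p\<^sup>2" "sqrt b = q\<^sup>2"
    by (rule real_sqrt_unique; simp add: a b flip: power_mult)+
  have root: "root 4 (a * b) = p * q" "root 4 (a / b) = p / q"
    by (simp_all add: p_def q_def real_root_mult real_root_divide)
  have powr: "a powr s = p powr (4 * s)" "b powr s = q powr (4 * s)" for s
    using pos by (simp_all add: a b flip: powr_powr powr_numeral)
  define K where "K = kantorovich2 (p / q) powr r1'"
  have "K > 0"
    using pos kantorovich2_pos[of "p / q"] by (simp add: K_def)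
  \<comment> \<open>\<open>X\<close> is the left side of the refined inequality and \<open>Y\<close>
    the Kantorovich term of the claim; in \<open>X * Y\<close> the factors \<open>K\<close> and
    \<open>inverse K\<close> cancel, leaving \<open>a * b\<close>.\<close>
  define X where "X = K * (p powr (4 * v) * q powr (4 - 4 * v))"
  define Y where "Y = inverse K * (p powr (4 - 4 * v) * q powr (4 * v))"
  have "X * Y = (p powr (4 * v) * p powr (4 - 4 * v)) * (q powr (4 - 4 * v) * q powr (4 * v))"
    using \<open>K > 0\<close> by (simp add: X_def Y_def)
  also have "\<dots> = ((p * q)\<^sup>2)\<^sup>2"
    using pos by (simp flip: powr_add power_mult add: power_mult_distrib)
  finally have "(2 * (p * q)\<^sup>2)\<^sup>2 \<le> (X + Y)\<^sup>2"
    using sum_squares_bound[of X Y] by (simp add: power2_sum power_mult_distrib)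
  then have "2 * (p * q)\<^sup>2 \<le> X + Y"
    using pos \<open>K > 0\<close> by (auto intro: power2_le_imp_le simp: X_def Y_def)
  moreover have "X \<le> (1 - 2 * v) * q ^ 4 + 2 * v * (p * q)\<^sup>2 - r1 * (p * q - q\<^sup>2)\<^sup>2"
    unfolding X_def K_def r1' using assms pos by (intro refined_young_kantorovich) auto
  \<comment> \<open>The right side is the bound on \<open>X\<close> without its \<open>r1\<close>
    term, minus \<open>2 * (p * q)\<^sup>2\<close>, so the claim follows from
    \<open>2 * (p * q)\<^sup>2 \<le> X + Y\<close>.\<close>
  moreover have "(1 - v) * (p\<^sup>2 - q\<^sup>2)\<^sup>2 - (1 - v) * p ^ 4 - v * q ^ 4
      = (1 - 2 * v) * q ^ 4 - 2 * (1 - v) * (p * q)\<^sup>2"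
    by (simp add: power2_eq_square power4_eq_xxxx algebra_simps)
  moreover have "kantorovich2 (root 4 (a / b)) powr (- r1') * (a powr (1 - v) * b powr v) = Y"
    by (simp add: root powr Y_def K_def powr_minus right_diff_distrib)
  ultimately show ?thesis
    unfolding sqrt root(1) a[symmetric] b[symmetric] by (simp add: algebra_simps)
qed

theorem theorem2p2:
  fixes a b v h r r1 r1' :: real
  assumes "a > 0" and "b > 0" and "0 < v" and "v < 1"
    and "h = b / a"
    and "r = min v (1 - v)"
    and "r1 = min (2 * r) (1 - 2 * r)"
    and "r1' = min (2 * r1) (1 - 2 * r1)"
  shows "(0 < v \<and> v \<le> 1 / 2 \<longrightarrow>
            (1 - v) * a + v * b
              \<le> (1 - v) * (sqrt a - sqrt b)\<^sup>2 - r1 * (root 4 (a * b) - sqrt b)\<^sup>2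
                 + kantorovich2 (root 4 h) powr (- r1') * (a powr (1 - v) * b powr v))
       \<and> (1 / 2 < v \<and> v < 1 \<longrightarrow>
            (1 - v) * a + v * b
              \<le> v * (sqrt a - sqrt b)\<^sup>2 - r1 * (root 4 (a * b) - sqrt a)\<^sup>2
                 + kantorovich2 (root 4 h) powr (- r1') * (a powr (1 - v) * b powr v))"
proof (intro conjI impI)
  assume v: "0 < v \<and> v \<le> 1 / 2"
  have "kantorovich2 (root 4 h) = kantorovich2 (root 4 (a / b))"
    using kantorovich2_inverse[of "root 4 (a / b)"] assms by (simp add: real_root_divide)
  then show "(1 - v) * a + v * b
      \<le> (1 - v) * (sqrt a - sqrt b)\<^sup>2 - r1 * (root 4 (a * b) - sqrt b)\<^sup>2
        + kantorovich2 (root 4 h) powr (- r1') * (a powr (1 - v) * b powr v)"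
    using reverse_young_kantorovich[of a b v r1 r1'] assms v by simp
next
  assume v: "1 / 2 < v \<and> v < 1"
  \<comment> \<open>\<open>r\<close> is symmetric in \<open>v\<close> and \<open>1 - v\<close>, so
    the exchange preserves \<open>r1\<close> and \<open>r1'\<close>; it also turns
    \<open>a / b\<close> into \<open>h\<close>, so no inversion is required here.\<close>
  then have "r = 1 - v"
    using assms by simp
  then show "(1 - v) * a + v * b
      \<le> v * (sqrt a - sqrt b)\<^sup>2 - r1 * (root 4 (a * b) - sqrt a)\<^sup>2
        + kantorovich2 (root 4 h) powr (- r1') * (a powr (1 - v) * b powr v)"
    using reverse_young_kantorovich[of b a "1 - v" r1 r1'] assms v
    by (simp add: mult.commute add.commute power2_commute[of "sqrt b" "sqrt a"])
qed

end
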